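(* Let $b > 1$ be an algebraic number, and let $\ell(b)$ be its reduced length. For each $\epsilon \in (1 - 1/\ell(b), 1]$, there exists a $(1-\epsilon)$-large set $S \subset \mathbb{R}$ that does not contain any affine copy of $\{b^n\}$.
   Context: The length $L(F)$ of a polynomial $F \in \mathbb{R}[x]$ is the sum of the absolute values of its coefficients. Let $\Gamma = \{a_0 + a_1 x + \cdots + a_m x^m \in \mathbb{R}[x] : m \in \mathbb{N},\ a_0 = 1 \text{ or } a_m = 1\}$. For an algebraic number $b$, let $P(x) = a_d x^d + \cdots + a_1 x + a_0 \in \mathbb{Z}[x]$, with $a_d > 0$, be its minimal polynomial over $\mathbb{Z}$ (i.e. the primitive irreducible integer polynomial with positive leading coefficient vanishing at $b$). The reduced length of $b$ is $\ell(b) = \inf_{G \in \Gamma} L(PG)$. $|A|$ denotes the Lebesgue measure of a measurable set $A \subseteq \mathbb{R}$. For $\epsilon \in (0,1]$, a $(1-\epsilon)$-large set is a Lebesgue measurable set $S \subseteq \mathbb{R}$ such that $|S \cap I| \geq 1-\epsilon$ for every interval $I \subset \mathbb{R}$ of unit length. An affine copy of $\{b^n\}$ is a set of the form $\{x b^n + t : n \in \mathbb{N}\}$ with $x \in \mathbb{R} \setminus \{0\}$ and $t \in \mathbb{R}$. *)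

theory Defs
  imports "HOL-Analysis.Analysis"
begin

definition poly_length :: "real poly \<Rightarrow> real" where
  "poly_length F = (\<Sum>i\<le>degree F. \<bar>coeff F i\<bar>)"

text \<open>In \<open>a\<^sub>0 + \<dots> + a\<^sub>m x\<^sup>m\<close> the coefficient \<open>a\<^sub>m\<close> may vanish, but not when the
  condition \<open>a\<^sub>m = 1\<close> is used, so \<open>a\<^sub>m\<close> is then the leading coefficient.\<close>
definition Gamma_polys :: "real poly set" where
  "Gamma_polys = {G. coeff G 0 = 1 \<or> lead_coeff G = 1}"

definition is_min_int_poly :: "int poly \<Rightarrow> real \<Rightarrow> bool" where
  "is_min_int_poly P b \<longleftrightarrow>
     irreducible P \<and> content P = 1 \<and> lead_coeff P > 0 \<and> poly (map_poly real_of_int P) b = 0"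

definition min_int_poly :: "real \<Rightarrow> int poly" where
  "min_int_poly b = (THE P. is_min_int_poly P b)"

text \<open>The definite description in \<open>min_int_poly\<close> is meaningful for every algebraic \<open>b\<close>.\<close>
lemma ex1_min_int_poly:
  assumes "algebraic b"
  shows "\<exists>!P. is_min_int_poly P b"
proof -
  define ev where "ev P = poly (map_poly real_of_int P) b" for P
  have ev_mult: "ev (p * q) = ev p * ev q" for p q
  proof -
    have "map_poly real_of_int (p * q) = map_poly real_of_int p * map_poly real_of_int q"
      by (rule poly_eqI) (simp add: coeff_map_poly coeff_mult)
    then show ?thesis by (simp add: ev_def)
  qed
  have ev_add: "ev (p + q) = ev p + ev q" for p q
  proof -
    have "map_poly real_of_int (p + q) = map_poly real_of_int p + map_poly real_of_int q"
      by (rule poly_eqI) (simp add: coeff_map_poly)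
    then show ?thesis by (simp add: ev_def)
  qed
  have ev_const: "ev [:c:] = of_int c" for c
    by (simp add: ev_def map_poly_pCons)
  have ev_smult: "ev (smult c p) = of_int c * ev p" for c p
    using ev_mult[of "[:c:]" p] by (simp add: ev_const)
  obtain p0 where p0: "p0 \<noteq> 0" "ev p0 = 0"
    using assms unfolding ev_def by (elim algebraicE') auto
  define Z where "Z P \<longleftrightarrow> P \<noteq> 0 \<and> ev P = 0" for P
  define D0 where "D0 = arg_min degree Z"
  have D0: "Z D0" and D0_min: "\<And>Q. Z Q \<Longrightarrow> degree D0 \<le> degree Q"
    using arg_min_nat_lemma[of Z p0 degree] p0 by (auto simp: D0_def Z_def)
  have D0_nz: "D0 \<noteq> 0" using D0 by (simp add: Z_def)
  define D1 where "D1 = primitive_part D0"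
  define D where "D = smult (sgn (lead_coeff D1)) D1"
  have D1_nz: "D1 \<noteq> 0" and D1_content: "content D1 = 1" and D1_deg: "degree D1 = degree D0"
    using D0_nz by (auto simp: D1_def)
  have D1_ev: "ev D1 = 0"
    using D0 D0_nz ev_smult[of "content D0" D1] by (simp add: Z_def D1_def)
  have lead_D1: "lead_coeff D1 \<noteq> 0" using D1_nz by simp
  have D_nz: "D \<noteq> 0" and D_deg: "degree D = degree D0"
    using lead_D1 D1_deg by (auto simp: D_def sgn_if)
  have D_content: "content D = 1"
    using D1_content lead_D1 unfolding D_def by (simp add: sgn_if)
  have D_pos: "lead_coeff D > 0"
  proof -
    have "lead_coeff D = \<bar>lead_coeff D1\<bar>"
      by (simp add: D_def abs_sgn mult.commute)
    then show ?thesis using lead_D1 by linarith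
  qed
  have D_ev: "ev D = 0" by (simp add: D_def ev_smult D1_ev)
  have const_unit: "A dvd 1" if A: "A dvd D" "degree A = 0" for A
  proof -
    obtain c where c: "A = [:c:]" using A(2) by (metis degree_eq_zeroE)
    have "c dvd content D" using A(1) unfolding c by (simp add: const_poly_dvd_iff_dvd_content)
    then show ?thesis by (simp add: c D_content is_unit_const_poly_iff)
  qed
  have "irreducible D"
  proof (rule irreducibleI)
    show "D \<noteq> 0" by (fact D_nz)
    show "\<not> D dvd 1"
    proof
      assume "D dvd 1"
      then obtain E where E: "1 = D * E" by (elim dvdE)
      have "ev 1 = 0" unfolding E by (simp add: ev_mult D_ev)
      then show False using ev_const[of 1] by (simp add: one_pCons)
    qed
    fix A B assume AB: "D = A * B"
    have nz: "A \<noteq> 0" "B \<noteq> 0" using AB D_nz by auto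
    have deg: "degree D = degree A + degree B" using AB nz by (simp add: degree_mult_eq)
    have "ev A = 0 \<or> ev B = 0" using AB D_ev ev_mult by auto
    then show "A dvd 1 \<or> B dvd 1"
    proof
      assume "ev A = 0"
      then have "degree B = 0" using D0_min[of A] nz deg D_deg by (simp add: Z_def)
      then show ?thesis using const_unit[of B] AB by simp
    next
      assume "ev B = 0"
      then have "degree A = 0" using D0_min[of B] nz deg D_deg by (simp add: Z_def)
      then show ?thesis using const_unit[of A] AB by simp
    qed
  qed
  then have D: "is_min_int_poly D b"
    using D_content D_pos D_ev by (simp add: is_min_int_poly_def ev_def)
  moreover have "P = D" if "is_min_int_poly P b" for P
  proof -
    have P: "irreducible P" "content P = 1" "lead_coeff P > 0" "ev P = 0"
      using that by (auto simp: is_min_int_poly_def ev_def)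
    obtain a q where aq: "a \<noteq> 0" "smult a P = D * q + pseudo_mod P D"
      using pseudo_mod(1)[OF D_nz] by blast
    have "ev (smult a P) = 0" by (simp add: ev_smult P)
    then have "ev (pseudo_mod P D) = 0" unfolding aq(2) by (simp add: ev_add ev_mult D_ev)
    then have "pseudo_mod P D = 0"
      using pseudo_mod(2)[OF D_nz, of P] D0_min[of "pseudo_mod P D"] D_deg
      unfolding Z_def by linarith
    then have "D dvd smult a P" using aq(2) by simp
    then have "primitive_part D dvd primitive_part (smult a P)" by blast
    moreover have "primitive_part D = D"
      using D_content by (simp add: primitive_part_prim)
    moreover have "primitive_part (smult a P) = smult (unit_factor a) P"
      using P(2) by (simp add: primitive_part_smult primitive_part_prim)
    ultimately have "D dvd smult (unit_factor a) P" by simp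
    then have "D dvd P" using aq(1) by (simp add: sgn_if split: if_splits)
    then obtain u where u: "P = D * u" by (elim dvdE)
    then have "u dvd 1"
      using irreducibleD[OF P(1) u] \<open>irreducible D\<close> irreducible_not_unit by blast
    then obtain c where c: "u = [:c:]" "c dvd 1"
      using is_unit_polyE by blast
    then have "\<bar>c\<bar> = 1" by simp
    then have "c = 1 \<or> c = -1" by linarith
    then show "P = D" using u c P(3) D_pos by auto
  qed
  ultimately show ?thesis by blast
qed

definition reduced_length :: "real \<Rightarrow> real" where
  "reduced_length b =
     (INF G\<in>Gamma_polys. poly_length (map_poly real_of_int (min_int_poly b) * G))"

text \<open>A \<open>(1 - \<epsilon>)\<close>-large set is the case \<open>c = 1 - \<epsilon>\<close>. An interval with \<open>measure lebesgue I = 1\<close>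
  is bounded: the value \<open>measure\<close> assigns to a set of infinite measure is \<open>0\<close>.\<close>
definition large_set :: "real \<Rightarrow> real set \<Rightarrow> bool" where
  "large_set c S \<longleftrightarrow>
     S \<in> sets lebesgue \<and>
     (\<forall>I. is_interval I \<and> measure lebesgue I = 1 \<longrightarrow> measure lebesgue (S \<inter> I) \<ge> c)"

definition affine_copy_powers :: "real \<Rightarrow> real set \<Rightarrow> bool" where
  "affine_copy_powers b A \<longleftrightarrow> (\<exists>x t. x \<noteq> 0 \<and> A = {x * b ^ n + t | n :: nat. True})"

end

theory Submission
  imports Defs
begin

text \<open>
  Let \<open>P\<close> be the minimal polynomial of \<open>b\<close>. The condition on \<open>\<epsilon>\<close> leaves room for some
  \<open>G \<in> Gamma_polys\<close> and some \<open>\<delta> > 1 - \<epsilon>\<close> with \<open>\<delta> * L(P G) < 1\<close>, where \<open>L\<close> denotes the length.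
  The periodic set \<open>{y. frac y \<le> \<delta>}\<close> meets every unit interval in measure exactly \<open>\<delta>\<close>. It may
  contain affine copies of the powers of \<open>b\<close> (for instance when \<open>b\<close> is a Pisot number), but only
  for countably many scaling factors \<open>x\<close>, and these remaining copies are destroyed by removing a
  sparse set that costs each unit interval at most \<open>\<delta> - (1 - \<epsilon>)\<close>.

  Countability (\<open>countable_scalings_with_small_frac\<close>). Suppose that all fractional parts
  \<open>e n = frac (x * b ^ n + t)\<close> are at most \<open>\<delta>\<close>, and put \<open>k n = \<lfloor>x * b ^ n + t\<rfloor>\<close>. Let \<open>E\<close> be the shift
  operator on sequences. As \<open>P(b) = 0\<close>, the integer sequence \<open>s = P(E) k\<close> differs from \<open>- P(E) e\<close> by
  a constant, so it is bounded. Applying \<open>G(E)\<close> as well, \<open>G(E) s\<close> differs by a constant from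
  \<open>- (P G)(E) e\<close>, whose values lie within \<open>\<delta> * L(P G) < 1\<close> of each other. Since the last or the first
  coefficient of \<open>G\<close> is \<open>1\<close> and \<open>s\<close> is integral, \<open>degree G\<close> consecutive values of \<open>s\<close> determine
  the next or the previous one. A bounded integer sequence has finitely many such windows, so \<open>s\<close> is
  eventually periodic. An integer sequence \<open>k\<close> for which \<open>P(E) k\<close> has period \<open>p\<close> from index \<open>N\<close> on is
  determined by \<open>N\<close>, \<open>p\<close> and an initial segment of \<open>k\<close>, so there are only countably many of them;
  and \<open>x\<close> is recovered as the limit of \<open>k n / b ^ n\<close>.

  Removal (\<open>sparse_set_meeting_copies\<close>). Cut the range of the translations \<open>t\<close> into intervals of
  length \<open>\<eta>\<close>. For each of the countably many pairs of a scaling factor \<open>x\<close> and such an interval \<open>J\<close>,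
  one interval \<open>x * b ^ n + J\<close> meets all copies with factor \<open>x\<close> and translation in \<open>J\<close>. Because
  \<open>b ^ n\<close> is unbounded, \<open>n\<close> may be chosen so that these intervals are far apart.
\<close>

section \<open>Polynomials in the shift operator\<close>

text \<open>The value at \<open>n\<close> of \<open>F(E) u\<close>, where \<open>E\<close> is the operator that maps a sequence \<open>u\<close> to the
  sequence of the values \<open>u (n + 1)\<close>.\<close>

definition shift_poly :: "'a::comm_ring_1 poly \<Rightarrow> (nat \<Rightarrow> 'a) \<Rightarrow> nat \<Rightarrow> 'a" where
  "shift_poly F u n = (\<Sum>i\<le>degree F. coeff F i * u (n + i))"

lemma shift_poly_0 [simp]: "shift_poly 0 u n = 0"
  by (simp add: shift_poly_def)

lemma shift_poly_pCons [simp]: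
  "shift_poly (pCons a F) u n = a * u n + shift_poly F u (Suc n)"
proof (cases "F = 0")
  case True
  then show ?thesis by (simp add: shift_poly_def)
next
  case False
  then show ?thesis
    by (simp add: shift_poly_def degree_pCons_eq sum.atMost_Suc_shift del: sum.atMost_Suc)
qed

lemma shift_poly_add:
  "shift_poly (F + G) u n = shift_poly F u n + shift_poly G u n"
  by (induction F G arbitrary: n rule: poly_induct2) (simp_all add: algebra_simps)

lemma shift_poly_smult: "shift_poly (smult c F) u n = c * shift_poly F u n"
  by (induction F arbitrary: n) (simp_all add: algebra_simps)

text \<open>Composition of such operators is multiplication of polynomials: this is what brings the
  length of the product \<open>P * G\<close>, rather than of \<open>P\<close> alone, into the estimate.\<close>

lemma shift_poly_mult:
  "shift_poly (F * G) u n = shift_poly F (shift_poly G u) n"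
  by (induction F arbitrary: n) (simp_all add: shift_poly_add shift_poly_smult)

lemma shift_poly_diff:
  "shift_poly F (\<lambda>n. u n - v n) n = shift_poly F u n - shift_poly F v n"
  by (simp add: shift_poly_def algebra_simps sum_subtractf)

lemma shift_poly_of_int:
  "of_int (shift_poly P k n) = shift_poly (map_poly of_int P) (\<lambda>n. real_of_int (k n)) n"
  by (induction P arbitrary: n) (simp_all add: map_poly_pCons)

lemma shift_poly_geometric_progression:
  "shift_poly F (\<lambda>n. x * b ^ n + t) n = x * b ^ n * poly F b + t * poly F 1"
  by (induction F arbitrary: n) (simp_all add: algebra_simps)

lemma shift_poly_oscillation_le:
  assumes "\<And>i. e i \<in> {0..\<delta>}"
  shows "\<bar>shift_poly F e n - shift_poly F e n'\<bar> \<le> \<delta> * poly_length F"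
proof -
  have "\<bar>shift_poly F e n - shift_poly F e n'\<bar> =
      \<bar>\<Sum>i\<le>degree F. coeff F i * (e (n + i) - e (n' + i))\<bar>"
    by (simp add: shift_poly_def algebra_simps sum_subtractf)
  also have "\<dots> \<le> (\<Sum>i\<le>degree F. \<bar>coeff F i * (e (n + i) - e (n' + i))\<bar>)"
    by (rule sum_abs)
  also have "\<dots> \<le> (\<Sum>i\<le>degree F. \<delta> * \<bar>coeff F i\<bar>)"
  proof (rule sum_mono)
    fix i
    have "\<bar>e (n + i) - e (n' + i)\<bar> \<le> \<delta>"
      using assms[of "n + i"] assms[of "n' + i"] by (auto simp: abs_le_iff)
    from mult_left_mono[OF this, of "\<bar>coeff F i\<bar>"]
    show "\<bar>coeff F i * (e (n + i) - e (n' + i))\<bar> \<le> \<delta> * \<bar>coeff F i\<bar>"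
      by (simp add: abs_mult mult.commute)
  qed
  finally show ?thesis by (simp add: poly_length_def sum_distrib_left)
qed

section \<open>Sequences with finitely many values and deterministic windows\<close>

text \<open>By the pigeonhole principle for the finitely many words of length \<open>m\<close>, some window recurs
  within a distance \<open>M\<close> that does not depend on the place \<open>N\<close> where the search starts. The
  uniformity matters for the backward argument below.\<close>

lemma repeated_window:
  fixes s :: "nat \<Rightarrow> 'a"
  assumes "finite (range s)"
  obtains M where "\<And>N. \<exists>n d. N \<le> n \<and> 0 < d \<and> d \<le> M \<and> (\<forall>j<m. s (n + j) = s (n + d + j))"
proof -
  define w where "w n = map (\<lambda>j. s (n + j)) [0..<m]" for n
  define W where "W = {xs. set xs \<subseteq> range s \<and> length xs = m}"
  have fin: "finite W" using assms by (simp add: W_def finite_lists_length_eq)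
  have "\<exists>n d. N \<le> n \<and> 0 < d \<and> d \<le> card W \<and> (\<forall>j<m. s (n + j) = s (n + d + j))" for N
  proof -
    have "w ` {N..N + card W} \<subseteq> W" by (auto simp: w_def W_def)
    then have "card (w ` {N..N + card W}) < card {N..N + card W}"
      using card_mono[OF fin] by (simp add: less_Suc_eq_le)
    then have "\<not> inj_on w {N..N + card W}" by (rule pigeonhole)
    then obtain n n' where n: "N \<le> n" "n < n'" "n' \<le> N + card W" "w n = w n'"
      by (metis atLeastAtMost_iff linorder_inj_onI')
    have "s (n + j) = s (n' + j)" if "j < m" for j
      using arg_cong[OF n(4), of "\<lambda>xs. xs ! j"] that by (simp add: w_def)
    then show ?thesis using n by (intro exI[of _ n] exI[of _ "n' - n"]) auto
  qed
  then show ?thesis by (rule that)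
qed

lemma eventually_periodic_if_window_determines_next:
  fixes s :: "nat \<Rightarrow> 'a"
  assumes "finite (range s)"
    and next_eq: "\<And>n n'. (\<And>j. j < m \<Longrightarrow> s (n + j) = s (n' + j)) \<Longrightarrow> s (n + m) = s (n' + m)"
  shows "\<exists>N p. 0 < p \<and> (\<forall>n\<ge>N. s (n + p) = s n)"
proof -
  obtain n d where d: "0 < d" and w: "\<And>j. j < m \<Longrightarrow> s (n + j) = s (n + d + j)"
    using repeated_window[OF assms(1), of m] by metis
  have "s (n + r) = s (n + d + r)" for r
  proof (induction r rule: less_induct)
    case (less r)
    show ?case
    proof (cases "r < m")
      case False
      have "s ((n + (r - m)) + j) = s ((n + d + (r - m)) + j)" if "j < m" for j
        using less.IH[of "r - m + j"] that False by (simp add: add.assoc)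
      from next_eq[OF this] show ?thesis using False by simp
    qed (rule w)
  qed
  note shifted = this
  have "s (k + d) = s k" if "n \<le> k" for k
    using shifted[of "k - n"] that by (simp add: add.commute add.left_commute)
  then show ?thesis using d by blast
qed

text \<open>A repetition of windows at distance \<open>d\<close> beyond an index propagates back to all smaller
  indices, but \<open>d\<close> depends on the index. As all these distances are at most \<open>M\<close>, they all divide
  \<open>fact M\<close>, which is therefore a common period.\<close>

lemma periodic_if_window_determines_previous:
  fixes s :: "nat \<Rightarrow> 'a"
  assumes "finite (range s)"
    and prev_eq: "\<And>n n'. (\<And>j. 0 < j \<Longrightarrow> j \<le> m \<Longrightarrow> s (n + j) = s (n' + j)) \<Longrightarrow> s n = s n'"
  shows "\<exists>p>0. \<forall>n. s (n + p) = s n"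
proof -
  obtain M where M: "\<And>N. \<exists>n d. N \<le> n \<and> 0 < d \<and> d \<le> M \<and> (\<forall>j<m. s (n + j) = s (n + d + j))"
    using repeated_window[OF assms(1), of m] by blast
  have "s (k + fact M) = s k" for k
  proof -
    obtain n d where n: "k + fact M \<le> n" and d: "0 < d" "d \<le> M"
      and w: "\<And>j. j < m \<Longrightarrow> s (n + j) = s (n + d + j)"
      using M by metis
    have step_d: "s i = s (i + d)" if "i < n + m" for i
      using that
    proof (induction i rule: measure_induct_rule[of "\<lambda>i. n + m - i"])
      case (less i)
      show ?case
      proof (cases "i < n")
        case True
        have "s (i + j) = s (i + d + j)" if "0 < j" "j \<le> m" for j
          using less.IH[of "i + j"] that True by (simp add: ac_simps)
        then show ?thesis by (rule prev_eq)
      next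
        case False
        then show ?thesis using w[of "i - n"] less.prems by (simp add: ac_simps)
      qed
    qed
    have "s (k + c * d) = s k" if "c * d \<le> fact M" for c
      using that
    proof (induction c)
      case (Suc c)
      then have "k + c * d < n" using n d by simp
      then have "s (k + c * d) = s (k + c * d + d)" using step_d by simp
      then show ?case using Suc by (simp add: algebra_simps)
    qed simp
    moreover obtain c where "fact M = d * c"
      using dvd_fact[of d M] d by (auto elim: dvdE)
    ultimately show ?thesis by (metis mult.commute order_refl)
  qed
  then show ?thesis by (intro exI[of _ "fact M"]) simp
qed

section \<open>Countably many scaling factors\<close>

text \<open>For fixed \<open>N\<close> and \<open>p\<close>, the equation at \<open>n \<ge> N\<close> determines \<open>k (n + p + degree P)\<close> from earlier
  values because the leading coefficient is nonzero. So \<open>k\<close> is encoded by the finite list of its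
  first \<open>N + p + degree P\<close> values.\<close>

lemma countable_eventually_periodic_shift_poly:
  fixes P :: "int poly"
  assumes "P \<noteq> 0"
  shows "countable {k :: nat \<Rightarrow> int. \<exists>N p. 0 < p \<and>
    (\<forall>n\<ge>N. shift_poly P k (n + p) = shift_poly P k n)}"
proof -
  define d where "d = degree P"
  define K where "K N p = {k :: nat \<Rightarrow> int.
    0 < p \<and> (\<forall>n\<ge>N. shift_poly P k (n + p) = shift_poly P k n)}" for N p
  have "countable (K N p)" for N p
  proof (rule countableI'[of "\<lambda>k. to_nat (map k [0..<N + p + d])"], rule inj_onI)
    fix k k' assume k: "k \<in> K N p" "k' \<in> K N p"
      and "to_nat (map k [0..<N + p + d]) = to_nat (map k' [0..<N + p + d])"
    then have init: "k i = k' i" if "i < N + p + d" for i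
      using that by simp
    define D where "D i = k i - k' i" for i
    have p: "0 < p" using k by (simp add: K_def)
    have D_per: "shift_poly P D (n + p) = shift_poly P D n" if "N \<le> n" for n
      using k that by (simp add: K_def D_def[abs_def] shift_poly_diff)
    have "D i = 0" for i
    proof (induction i rule: less_induct)
      case (less i)
      show ?case
      proof (cases "i < N + p + d")
        case False
        define n where "n = i - p - d"
        have n: "N \<le> n" "n + p + d = i" using False by (auto simp: n_def)
        have "shift_poly P D n = 0"
          using less.IH n p unfolding shift_poly_def d_def
          by (intro sum.neutral) auto
        then have "0 = shift_poly P D (n + p)" using D_per n by simp
        also have "\<dots> = (\<Sum>j<d. coeff P j * D (n + p + j)) + lead_coeff P * D i"
          using n by (simp add: shift_poly_def d_def lessThan_Suc_atMost[symmetric])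
        also have "(\<Sum>j<d. coeff P j * D (n + p + j)) = 0"
          using less.IH n by (intro sum.neutral) auto
        finally show ?thesis using assms by simp
      qed (simp add: D_def init)
    qed
    then show "k = k'" by (auto simp: D_def)
  qed
  then have "countable (\<Union>N p. K N p)" by blast
  moreover have "(\<Union>N p. K N p) = {k. \<exists>N p. 0 < p \<and>
    (\<forall>n\<ge>N. shift_poly P k (n + p) = shift_poly P k n)}" by (auto simp: K_def)
  ultimately show ?thesis by simp
qed

text \<open>This is where the length of \<open>P * G\<close> and the normalisation of \<open>G\<close> are used: two windows that agree
  except at the end with coefficient \<open>1\<close> give values of \<open>G(E) s\<close> that differ by the integer
  difference of the two remaining entries, and this difference is less than \<open>1\<close> in absolute value.\<close>

lemma eventually_periodic_shift_poly_floor: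
  fixes P :: "int poly" and G :: "real poly" and b x t \<delta> :: real
  defines "Q \<equiv> map_poly real_of_int P"
  assumes root: "poly Q b = 0"
    and G: "G \<in> Gamma_polys" "\<delta> * poly_length (Q * G) < 1"
    and frac: "\<And>n. frac (x * b ^ n + t) \<le> \<delta>"
  defines "k \<equiv> \<lambda>n. \<lfloor>x * b ^ n + t\<rfloor>"
  shows "\<exists>N p. 0 < p \<and> (\<forall>n\<ge>N. shift_poly P k (n + p) = shift_poly P k n)"
proof -
  define e where "e n = frac (x * b ^ n + t)" for n
  define s where "s = shift_poly P k"
  define m where "m = degree G"
  have e: "e n \<in> {0..\<delta>}" for n using frac by (simp add: e_def)
  have s_e: "real_of_int (s n) = t * poly Q 1 - shift_poly Q e n" for n
  proof -
    have "(\<lambda>n. real_of_int (k n)) = (\<lambda>n. (x * b ^ n + t) - e n)"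
      by (auto simp: k_def e_def frac_def)
    then show ?thesis
      by (simp add: s_def shift_poly_of_int Q_def[symmetric] shift_poly_diff
          shift_poly_geometric_progression root)
  qed
  have fin: "finite (range s)"
  proof (rule finite_subset)
    show "range s \<subseteq> {s 0 - \<lceil>\<delta> * poly_length Q\<rceil>..s 0 + \<lceil>\<delta> * poly_length Q\<rceil>}"
    proof clarify
      fix n
      have "\<bar>real_of_int (s n) - real_of_int (s 0)\<bar> \<le> \<delta> * poly_length Q"
        using shift_poly_oscillation_le[of e \<delta> Q n 0, OF e] by (simp add: s_e)
      then show "s n \<in> {s 0 - \<lceil>\<delta> * poly_length Q\<rceil>..s 0 + \<lceil>\<delta> * poly_length Q\<rceil>}"
        unfolding atLeastAtMost_iff by linarith
    qed
  qed simp
  have G_s: "\<bar>\<Sum>j\<le>m. coeff G j * (real_of_int (s (n + j)) - real_of_int (s (n' + j)))\<bar> < 1"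
    for n n'
  proof -
    have "(\<Sum>j\<le>m. coeff G j * (real_of_int (s (n + j)) - real_of_int (s (n' + j)))) =
        shift_poly G (shift_poly Q e) n' - shift_poly G (shift_poly Q e) n"
      unfolding shift_poly_def[of G] m_def sum_subtractf[symmetric] s_e
      by (simp add: algebra_simps)
    also have "\<dots> = shift_poly (Q * G) e n' - shift_poly (Q * G) e n"
      by (simp add: shift_poly_mult[symmetric] mult.commute)
    finally show ?thesis
      using shift_poly_oscillation_le[of e \<delta> "Q * G" n' n, OF e] G(2) by linarith
  qed
  from G(1) consider "coeff G m = 1" | "coeff G 0 = 1" by (auto simp: Gamma_polys_def m_def)
  then show ?thesis unfolding s_def[symmetric]
  proof cases
    case 1
    show "\<exists>N p. 0 < p \<and> (\<forall>n\<ge>N. s (n + p) = s n)"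
    proof (rule eventually_periodic_if_window_determines_next[OF fin, of m])
      fix n n' assume eq: "\<And>j. j < m \<Longrightarrow> s (n + j) = s (n' + j)"
      have "(\<Sum>j\<le>m. coeff G j * (real_of_int (s (n + j)) - real_of_int (s (n' + j)))) =
          real_of_int (s (n + m)) - real_of_int (s (n' + m))"
        using eq 1 by (simp add: lessThan_Suc_atMost[symmetric])
      with G_s[of n n'] show "s (n + m) = s (n' + m)" by linarith
    qed
  next
    case 2
    have "\<exists>p>0. \<forall>n. s (n + p) = s n"
    proof (rule periodic_if_window_determines_previous[OF fin, of m])
      fix n n' assume eq: "\<And>j. 0 < j \<Longrightarrow> j \<le> m \<Longrightarrow> s (n + j) = s (n' + j)"
      have "(\<Sum>j\<le>m. coeff G j * (real_of_int (s (n + j)) - real_of_int (s (n' + j)))) =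
          real_of_int (s n) - real_of_int (s n')"
        using eq[of "Suc _"] 2 by (subst sum.atMost_shift) (simp add: Suc_le_eq)
      with G_s[of n n'] show "s n = s n'" by linarith
    qed
    then show "\<exists>N p. 0 < p \<and> (\<forall>n\<ge>N. s (n + p) = s n)" by blast
  qed
qed

text \<open>The translation \<open>t\<close> disappears from the limit of \<open>k n / b ^ n\<close>, so that only the scaling factor
  is controlled. For a given factor there may be uncountably many admissible translations.\<close>

lemma countable_scalings_with_small_frac:
  fixes P :: "int poly" and G :: "real poly" and b \<delta> :: real
  assumes "b > 1" "P \<noteq> 0" "poly (map_poly real_of_int P) b = 0"
    and "G \<in> Gamma_polys" "\<delta> * poly_length (map_poly real_of_int P * G) < 1"
  shows "countable {x. \<exists>t. \<forall>n. frac (x * b ^ n + t) \<le> \<delta>}"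
proof -
  define K where "K = {k :: nat \<Rightarrow> int. \<exists>N p. 0 < p \<and>
    (\<forall>n\<ge>N. shift_poly P k (n + p) = shift_poly P k n)}"
  have "{x. \<exists>t. \<forall>n. frac (x * b ^ n + t) \<le> \<delta>} \<subseteq> (\<lambda>k. lim (\<lambda>n. real_of_int (k n) / b ^ n)) ` K"
  proof clarify
    fix x t assume frac: "\<forall>n. frac (x * b ^ n + t) \<le> \<delta>"
    define k where "k = (\<lambda>n. \<lfloor>x * b ^ n + t\<rfloor>)"
    have "k \<in> K"
      using eventually_periodic_shift_poly_floor[OF assms(3-5), of x t] frac
      by (simp add: K_def k_def)
    have "(\<lambda>n. (1 / b) ^ n) \<longlonglongrightarrow> 0"
      using assms(1) by (intro LIMSEQ_realpow_zero) auto
    then have inv: "(\<lambda>n. 1 / b ^ n) \<longlonglongrightarrow> 0" by (simp add: power_one_over)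
    have "(\<lambda>n. frac (x * b ^ n + t) * (1 / b ^ n)) \<longlonglongrightarrow> 0"
    proof (rule tendsto_sandwich[OF _ _ tendsto_const inv])
      show "\<forall>\<^sub>F n in sequentially. frac (x * b ^ n + t) * (1 / b ^ n) \<le> 1 / b ^ n"
        using assms(1) frac_lt_1[THEN less_imp_le]
        by (intro always_eventually allI mult_left_le_one_le) auto
    qed (use assms(1) in auto)
    then have "(\<lambda>n. x + t * (1 / b ^ n) - frac (x * b ^ n + t) * (1 / b ^ n)) \<longlonglongrightarrow> x + t * 0 - 0"
      by (intro tendsto_intros inv)
    also have "(\<lambda>n. x + t * (1 / b ^ n) - frac (x * b ^ n + t) * (1 / b ^ n)) =
        (\<lambda>n. real_of_int (k n) / b ^ n)"
      using assms(1) by (auto simp: k_def frac_def field_simps)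
    finally have "lim (\<lambda>n. real_of_int (k n) / b ^ n) = x" by (simp add: limI)
    with \<open>k \<in> K\<close> show "x \<in> (\<lambda>k. lim (\<lambda>n. real_of_int (k n) / b ^ n)) ` K" by blast
  qed
  moreover have "countable K"
    using countable_eventually_periodic_shift_poly[OF assms(2)] by (simp add: K_def)
  ultimately show ?thesis by (meson countable_image countable_subset)
qed

section \<open>A sparse set that meets countably many families of copies\<close>

lemma sparse_set_meeting_copies:
  fixes b \<eta> :: real
  assumes "b > 1" "0 < \<eta>" "\<eta> \<le> 1" "countable X"
  obtains R where "R \<in> sets lebesgue"
    and "\<And>a. \<exists>c. R \<inter> {a..a + 1} \<subseteq> {c..c + \<eta>}"
    and "\<And>x t. x \<in> X \<Longrightarrow> x \<noteq> 0 \<Longrightarrow> \<exists>n. x * b ^ n + t \<in> R"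
proof -
  \<comment> \<open>The factor \<open>1\<close> only serves to make \<open>Z\<close> nonempty, so that it can be enumerated.\<close>
  define Z where "Z = insert 1 (X - {0}) \<times> (UNIV :: int set)"
  define q where "q = from_nat_into Z"
  have Z: "countable Z" "Z \<noteq> {}" using assms(4) by (auto simp: Z_def)
  have q_nz: "fst (q i) \<noteq> 0" for i
    using from_nat_into[OF Z(2), of i] by (auto simp: q_def Z_def)
  define c where "c i n = fst (q i) * b ^ n + of_int (snd (q i)) * \<eta>" for i n
  have far: "\<exists>n. \<bar>c i n\<bar> > B" for i B
  proof -
    obtain n where "(B + \<bar>of_int (snd (q i)) * \<eta>\<bar>) / \<bar>fst (q i)\<bar> < b ^ n"
      using real_arch_pow[OF assms(1)] by blast
    then have "B + \<bar>of_int (snd (q i)) * \<eta>\<bar> < \<bar>fst (q i) * b ^ n\<bar>"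
      using q_nz[of i] assms(1) by (simp add: field_simps abs_mult)
    then show ?thesis unfolding c_def by (intro exI[of _ n]) linarith
  qed
  \<comment> \<open>A gap of \<open>3\<close> between left end points leaves more than \<open>1\<close> between the intervals of length
     \<open>\<eta> \<le> 1\<close>, so that a unit interval meets at most one of them.\<close>
  obtain n where n: "\<And>i. \<bar>c i (n i)\<bar> + 3 < \<bar>c (Suc i) (n (Suc i))\<bar>"
    using dependent_nat_choice[of "\<lambda>_ _. True" "\<lambda>i m m'. \<bar>c i m\<bar> + 3 < \<bar>c (Suc i) m'\<bar>"] far
    by blast
  define p where "p i = c i (n i)" for i
  have grow: "\<bar>p i\<bar> + 3 \<le> \<bar>p j\<bar>" if "i < j" for i j
    using that
  proof (induction j)
    case (Suc j)
    then show ?case using n[of j] by (cases "i = j") (auto simp: p_def)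
  qed simp
  define R where "R = (\<Union>i. {p i..p i + \<eta>})"
  show ?thesis
  proof
    show "R \<in> sets lebesgue" unfolding R_def by (intro sets.countable_UN) auto
  next
    fix a
    show "\<exists>c. R \<inter> {a..a + 1} \<subseteq> {c..c + \<eta>}"
    proof (cases "\<exists>i. {p i..p i + \<eta>} \<inter> {a..a + 1} \<noteq> {}")
      case True
      then obtain i u where u: "u \<in> {p i..p i + \<eta>}" "u \<in> {a..a + 1}" by blast
      have "j = i" if v: "v \<in> {p j..p j + \<eta>}" "v \<in> {a..a + 1}" for j v
      proof (rule ccontr)
        assume "j \<noteq> i"
        then have "\<bar>p i - p j\<bar> \<ge> 3"
          using grow[of i j] grow[of j i] by (cases "i < j") auto
        then show False using u v assms(3) by auto
      qed
      then have "R \<inter> {a..a + 1} \<subseteq> {p i..p i + \<eta>}" by (auto simp: R_def)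
      then show ?thesis by blast
    next
      case False
      then have "R \<inter> {a..a + 1} = {}" unfolding R_def by blast
      then show ?thesis by simp
    qed
  next
    fix x t assume x: "x \<in> X" "x \<noteq> 0"
    define k where "k = \<lfloor>t / \<eta>\<rfloor>"
    have "of_int k \<le> t / \<eta>" "t / \<eta> \<le> of_int k + 1" unfolding k_def by linarith+
    then have k: "of_int k * \<eta> \<le> t" "t \<le> of_int k * \<eta> + \<eta>"
      using assms(2) by (auto simp: field_simps)
    have "(x, k) \<in> Z" using x by (simp add: Z_def)
    then obtain i where "q i = (x, k)"
      using from_nat_into_surj[OF Z(1)] unfolding q_def by blast
    then have "x * b ^ n i + t \<in> {p i..p i + \<eta>}"
      using k by (simp add: p_def c_def)
    then show "\<exists>n. x * b ^ n + t \<in> R" by (auto simp: R_def)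
  qed
qed

section \<open>Large sets\<close>

text \<open>Unbounded intervals are excluded because \<open>measure\<close> is \<open>0\<close> on sets of infinite measure.\<close>

lemma unit_measure_interval:
  fixes I :: "real set"
  assumes "is_interval I" "measure lebesgue I = 1"
  obtains a where "{a<..<a + 1} \<subseteq> I" "I \<subseteq> {a..a + 1}"
proof -
  have meas: "I \<in> lmeasurable"
  proof (rule fmeasurableI)
    show "I \<in> sets lebesgue" using assms(2) measure_notin_sets[of I lebesgue] by auto
    show "emeasure lebesgue I < \<infinity>"
    proof (rule ccontr)
      assume "\<not> emeasure lebesgue I < \<infinity>"
      then have "emeasure lebesgue I = \<infinity>" by (simp add: not_less top_unique)
      then show False using assms(2) by (simp add: measure_def)
    qed
  qed
  have diam: "v - u \<le> 1" if "u \<in> I" "v \<in> I" "u \<le> v" for u v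
  proof -
    have "{u..v} \<subseteq> I" using assms(1) that unfolding is_interval_1 by (meson atLeastAtMost_iff subsetI)
    then have "measure lebesgue {u..v} \<le> 1"
      using measure_mono_fmeasurable[of "{u..v}" I lebesgue] meas assms(2) by simp
    then show ?thesis using that by simp
  qed
  have ne: "I \<noteq> {}" using assms(2) by auto
  then obtain w where w: "w \<in> I" by blast
  have near: "w - 1 \<le> v" "v \<le> w + 1" if "v \<in> I" for v
    using diam[OF w that] diam[OF that w] by linarith+
  have bdd: "bdd_below I" "bdd_above I"
    using near by (auto intro: bdd_belowI[of I "w - 1"] bdd_aboveI[of I "w + 1"])
  define a where "a = Inf I"
  define c where "c = Sup I"
  have sub: "I \<subseteq> {a..c}"
    using bdd by (auto simp: a_def c_def intro: cInf_lower cSup_upper)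
  have sup: "{a<..<c} \<subseteq> I"
  proof
    fix y assume "y \<in> {a<..<c}"
    then obtain u v where "u \<in> I" "u < y" "v \<in> I" "y < v"
      using cInf_less_iff[OF ne bdd(1)] less_cSup_iff[OF ne bdd(2)] by (auto simp: a_def c_def)
    then show "y \<in> I" using assms(1) by (meson is_interval_1 less_imp_le)
  qed
  have "a \<le> c" using sub w by auto
  moreover have "measure lebesgue I \<le> measure lebesgue {a..c}"
    using sub meas by (intro measure_mono_fmeasurable) auto
  moreover have "measure lebesgue {a<..<c} \<le> measure lebesgue I"
    using sup meas by (intro measure_mono_fmeasurable) auto
  ultimately have "c = a + 1" using assms(2) by simp
  with sub sup that show ?thesis by blast
qed

text \<open>The periodic set meets the unit interval after \<open>a\<close> in one or two pieces, according to whether \<open>a\<close>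
  falls into the gap above \<open>\<lfloor>a\<rfloor> + \<delta>\<close> or not. Open pieces avoid the end points and
  lose no measure.\<close>

lemma small_frac_in_unit_interval:
  fixes a \<delta> :: real
  assumes "0 \<le> \<delta>" "\<delta> \<le> 1"
  obtains T where "T \<in> lmeasurable" "T \<subseteq> {a<..<a + 1}"
    "\<And>y. y \<in> T \<Longrightarrow> frac y \<le> \<delta>" "measure lebesgue T = \<delta>"
proof -
  define N where "N = \<lfloor>a\<rfloor>"
  have N: "of_int N \<le> a" "a < of_int N + 1" by (auto simp: N_def)
  have frac: "frac y \<le> \<delta>" if "of_int j \<le> y" "y < of_int j + \<delta>" for j y
  proof -
    have "\<lfloor>y\<rfloor> = j" using that assms by (intro floor_unique) auto
    then show ?thesis using that by (simp add: frac_def)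
  qed
  show ?thesis
  proof (cases "a < of_int N + \<delta>")
    case True
    define T where "T = {a<..<of_int N + \<delta>} \<union> {of_int N + 1<..<a + 1}"
    show ?thesis
    proof (rule that[of T])
      show "T \<in> lmeasurable" unfolding T_def by (intro fmeasurable.Un) auto
      show "T \<subseteq> {a<..<a + 1}" using N True assms by (auto simp: T_def)
      show "frac y \<le> \<delta>" if "y \<in> T" for y
        using that N True frac[of N y] frac[of "N + 1" y] by (auto simp: T_def)
      have "measure lebesgue T = measure lebesgue {a<..<of_int N + \<delta>} +
          measure lebesgue {of_int N + 1<..<a + 1}"
        unfolding T_def using assms True N by (intro measure_Union) auto
      then show "measure lebesgue T = \<delta>" using True N by simp
    qed
  next
    case False
    define T where "T = {real_of_int N + 1<..<of_int N + 1 + \<delta>}"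
    show ?thesis
    proof (rule that[of T])
      show "T \<in> lmeasurable" by (simp add: T_def)
      show "T \<subseteq> {a<..<a + 1}" using N False assms by (auto simp: T_def)
      show "frac y \<le> \<delta>" if "y \<in> T" for y
        using that frac[of "N + 1" y] by (auto simp: T_def)
      show "measure lebesgue T = \<delta>" using assms by (simp add: T_def)
    qed
  qed
qed

lemma large_set_small_frac_diff_sparse:
  fixes \<delta> \<eta> :: real
  assumes "0 \<le> \<delta>" "\<delta> \<le> 1" "0 \<le> \<eta>"
    and R: "R \<in> sets lebesgue" "\<And>a. \<exists>c. R \<inter> {a..a + 1} \<subseteq> {c..c + \<eta>}"
  shows "large_set (\<delta> - \<eta>) ({y. frac y \<le> \<delta>} - R)"
  unfolding large_set_def
proof (intro conjI allI impI)
  have "{y \<in> space lborel. frac (y::real) \<le> \<delta>} \<in> sets lborel"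
    unfolding frac_def by measurable
  then have "{y. frac (y::real) \<le> \<delta>} \<in> sets lebesgue" by simp
  then show S: "{y. frac y \<le> \<delta>} - R \<in> sets lebesgue" using R(1) by blast
  fix I :: "real set" assume "is_interval I \<and> measure lebesgue I = 1"
  then obtain a where a: "{a<..<a + 1} \<subseteq> I" "I \<subseteq> {a..a + 1}"
    using unit_measure_interval by metis
  obtain T where T: "T \<in> lmeasurable" "T \<subseteq> {a<..<a + 1}"
    "\<And>y. y \<in> T \<Longrightarrow> frac y \<le> \<delta>" "measure lebesgue T = \<delta>"
    using small_frac_in_unit_interval[OF assms(1,2)] by metis
  obtain c where c: "R \<inter> {a..a + 1} \<subseteq> {c..c + \<eta>}" using R(2) by blast
  define V where "V = ({y. frac y \<le> \<delta>} - R) \<inter> I"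
  have I: "I \<in> lmeasurable"
    using \<open>is_interval I \<and> _\<close> a(2)
    by (meson bounded_closed_interval bounded_subset is_interval_convex measurable_convex)
  have V: "V \<in> lmeasurable"
    unfolding V_def using I S by (metis fmeasurable_Int_fmeasurable inf_commute)
  have "T \<subseteq> V \<union> {c..c + \<eta>}" using T(2,3) a c by (force simp: V_def)
  then have "\<delta> \<le> measure lebesgue (V \<union> {c..c + \<eta>})"
    using T(1,4) V measure_mono_fmeasurable[of T "V \<union> {c..c + \<eta>}" lebesgue]
    by (auto simp: fmeasurable.Un)
  also have "\<dots> \<le> measure lebesgue V + measure lebesgue {c..c + \<eta>}"
    using V by (intro measure_Un_le) auto
  also have "\<dots> = measure lebesgue V + \<eta>" using assms(3) by simp
  finally show "\<delta> - \<eta> \<le> measure lebesgue (({y. frac y \<le> \<delta>} - R) \<inter> I)"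
    by (simp add: V_def)
qed

section \<open>The reduced length\<close>

lemma min_int_poly_spec: "algebraic b \<Longrightarrow> is_min_int_poly (min_int_poly b) b"
  unfolding min_int_poly_def by (rule theI') (rule ex1_min_int_poly)

lemma abs_coeff_le_poly_length: "\<bar>coeff F i\<bar> \<le> poly_length F"
proof (cases "i \<le> degree F")
  case True
  then show ?thesis
    unfolding poly_length_def by (intro member_le_sum[of i "{..degree F}" "\<lambda>i. \<bar>coeff F i\<bar>"]) auto
next
  case False
  then show ?thesis by (simp add: coeff_eq_0 poly_length_def sum_nonneg)
qed

lemma coeff_0_min_int_poly_nonzero:
  assumes "is_min_int_poly P b" "b \<noteq> 0"
  shows "coeff P 0 \<noteq> 0"
proof
  assume "coeff P 0 = 0"
  then obtain Q where Q: "P = [:0, 1:] * Q" by (cases P) auto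
  have irr: "irreducible P" and root: "poly (map_poly real_of_int P) b = 0"
    using assms(1) by (auto simp: is_min_int_poly_def)
  have "\<not> [:0, 1:] dvd (1 :: int poly)" by (simp add: is_unit_poly_iff)
  then have "Q dvd 1" using irreducibleD[OF irr Q] by blast
  then obtain c where "Q = [:c:]" "c dvd 1" using is_unit_polyE by blast
  then show False using root assms(2) Q by (auto simp: map_poly_pCons)
qed

text \<open>The product has a constant or leading coefficient of absolute value at least \<open>1\<close>, since the outer
  coefficients of \<open>P\<close> are nonzero integers. Consequently the reduced length is at least \<open>1\<close>: without
  this, the hypothesis on \<open>\<epsilon>\<close> would admit \<open>\<epsilon> < 0\<close>.\<close>

lemma one_le_poly_length_multiple:
  assumes P: "is_min_int_poly P b" "b \<noteq> 0" and G: "G \<in> Gamma_polys"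
  shows "1 \<le> poly_length (map_poly real_of_int P * G)"
proof -
  let ?Q = "map_poly real_of_int P"
  have int_ge: "1 \<le> \<bar>real_of_int c\<bar>" if "c \<noteq> 0" for c using that by linarith
  from G consider "coeff G 0 = 1" | "lead_coeff G = 1" by (auto simp: Gamma_polys_def)
  then have "\<exists>i. 1 \<le> \<bar>coeff (?Q * G) i\<bar>"
  proof cases
    case 1
    then show ?thesis
      using int_ge[OF coeff_0_min_int_poly_nonzero[OF P]]
      by (intro exI[of _ 0]) (simp add: coeff_mult coeff_map_poly)
  next
    case 2
    have "lead_coeff P \<noteq> 0" using P(1) by (auto simp: is_min_int_poly_def)
    then show ?thesis
      using 2 int_ge[of "lead_coeff P"]
      by (intro exI[of _ "degree ?Q + degree G"])
         (simp only: coeff_mult_degree_sum, simp add: coeff_map_poly degree_map_poly)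
  qed
  then show ?thesis using abs_coeff_le_poly_length order_trans by blast
qed

theorem theorem1p8:
  fixes b :: real and \<epsilon> :: real
  assumes "b > 1"
    and "algebraic b"
    and "\<epsilon> \<in> {1 - 1 / reduced_length b <.. 1}"
  shows "\<exists>S. large_set (1 - \<epsilon>) S \<and> \<not> (\<exists>A. affine_copy_powers b A \<and> A \<subseteq> S)"
proof -
  define P where "P = min_int_poly b"
  define len where "len G = poly_length (map_poly real_of_int P * G)" for G
  have P: "is_min_int_poly P b" unfolding P_def using assms(2) by (rule min_int_poly_spec)
  then have P_nz: "P \<noteq> 0" and root: "poly (map_poly real_of_int P) b = 0"
    by (auto simp: is_min_int_poly_def)
  have len_ge: "1 \<le> len G" if "G \<in> Gamma_polys" for G
    using one_le_poly_length_multiple[OF P _ that] assms(1) by (simp add: len_def)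
  have ne: "Gamma_polys \<noteq> {}" by (auto simp: Gamma_polys_def intro: exI[of _ 1])
  have rl: "reduced_length b = (INF G\<in>Gamma_polys. len G)"
    by (simp add: reduced_length_def len_def P_def)
  have rl_ge: "1 \<le> reduced_length b"
    unfolding rl using len_ge by (intro cINF_greatest ne) auto
  \<comment> \<open>The strict inequality for \<open>\<epsilon>\<close> allows an approximate minimiser \<open>G\<close>, and then some room \<open>\<eta>\<close>
     for the sparse set.\<close>
  have "\<exists>G\<in>Gamma_polys. (1 - \<epsilon>) * len G < 1"
  proof (cases "\<epsilon> = 1")
    case False
    then have "reduced_length b < 1 / (1 - \<epsilon>)"
      using assms(3) rl_ge by (auto simp: field_simps)
    then obtain G where "G \<in> Gamma_polys" "len G < 1 / (1 - \<epsilon>)"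
      unfolding rl using cINF_less_iff[OF ne] len_ge by (metis bdd_belowI2)
    then show ?thesis using False assms(3) by (auto simp: field_simps)
  qed (use ne in auto)
  then obtain G where G: "G \<in> Gamma_polys" "(1 - \<epsilon>) * len G < 1" by blast
  then have len_pos: "0 < len G" using len_ge by force
  obtain \<delta> where \<delta>: "1 - \<epsilon> < \<delta>" "\<delta> < 1 / len G"
    using dense[of "1 - \<epsilon>" "1 / len G"] G(2) len_pos by (auto simp: field_simps)
  have "1 / len G \<le> 1" using len_ge[OF G(1)] by simp
  then have \<delta>01: "0 < \<delta>" "\<delta> \<le> 1" using \<delta> assms(3) by auto
  have \<delta>_len: "\<delta> * len G < 1" using \<delta>(2) len_pos by (simp add: field_simps)
  define \<eta> where "\<eta> = \<delta> - (1 - \<epsilon>)"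
  have \<eta>: "0 < \<eta>" "\<eta> \<le> 1" using \<delta>(1) \<delta>01 assms(3) by (auto simp: \<eta>_def)
  define X where "X = {x. \<exists>t. \<forall>n. frac (x * b ^ n + t) \<le> \<delta>}"
  have "countable X"
    unfolding X_def using countable_scalings_with_small_frac[OF assms(1) P_nz root G(1)] \<delta>_len
    by (simp add: len_def)
  then obtain R where R: "R \<in> sets lebesgue" "\<And>a. \<exists>c. R \<inter> {a..a + 1} \<subseteq> {c..c + \<eta>}"
    and hit: "\<And>x t. x \<in> X \<Longrightarrow> x \<noteq> 0 \<Longrightarrow> \<exists>n. x * b ^ n + t \<in> R"
    using sparse_set_meeting_copies[OF assms(1) \<eta>] by metis
  define S where "S = {y. frac y \<le> \<delta>} - R"
  have "large_set (1 - \<epsilon>) S"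
    using large_set_small_frac_diff_sparse[of \<delta> \<eta> R] R \<delta>01 \<eta> by (simp add: S_def \<eta>_def)
  moreover have "\<not> A \<subseteq> S" if copy: "affine_copy_powers b A" for A
  proof
    assume "A \<subseteq> S"
    obtain x t where x: "x \<noteq> 0" and A: "A = {x * b ^ n + t | n :: nat. True}"
      using copy unfolding affine_copy_powers_def by (elim exE conjE)
    have in_S: "x * b ^ n + t \<in> S" for n using \<open>A \<subseteq> S\<close> A by blast
    then have "x \<in> X" by (auto simp: S_def X_def)
    then show False using hit[OF _ x] in_S by (auto simp: S_def)
  qed
  ultimately show ?thesis by blast
qed

end
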